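(* Let $\mathcal{G}=(G^0,\mathcal{G}^1,r,s)$ be an ultragraph, let $\pi:C^*(\mathcal{G})\to B(H)$ be a permutative representation, and let $B$ be an orthonormal basis of $H$ satisfying the conditions in the definition of permutative representation. Then $\pi$ is unitarily equivalent to a representation of $C^*(\mathcal{G})$ on $l^2(\mathbb{N})$ which is induced from a $\mathcal{G}$-branching system on $\mathbb{N}$ equipped with the counting measure.
   Context: Standing conventions: $\mathbb{N}$ is the set of positive integers; measure spaces are $\sigma$-finite; C*-algebras are separable; all representations are on separable infinite-dimensional Hilbert spaces; a representation is a $*$-homomorphism into $B(H)$ (not assumed nondegenerate). Ultragraph: $\mathcal{G}=(G^0,\mathcal{G}^1,r,s)$ consists of countable sets $G^0$ (vertices) and $\mathcal{G}^1$ (edges), a map $s:\mathcal{G}^1\to G^0$ and a map $r:\mathcal{G}^1\to P(G^0)\setminus\{\emptyset\}$, $P(G^0)$ being the power set. $\mathcal{G}^0$ denotes the smallest subset of $P(G^0)$ containing $\{v\}$ for all $v\in G^0$ and $r(e)$ for all $e\in\mathcal{G}^1$, and closed under finite unions and nonempty finite intersections (intersections of nonempty finite families); $\emptyset$ is regarded as an element of $\mathcal{G}^0$. A vertex $v$ is identified with $\{v\}$ in subscripts. $C^*(\mathcal{G})$ is the universal C*-algebra generated by partial isometries $\{s_e:e\in\mathcal{G}^1\}$ with mutually orthogonal ranges and projections $\{p_A:A\in\mathcal{G}^0\}$ such that: (1) $p_\emptyset=0$, $p_Ap_B=p_{A\cap B}$, $p_{A\cup B}=p_A+p_B-p_{A\cap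 B}$; (2) $s_e^*s_e=p_{r(e)}$; (3) $s_es_e^*\le p_{s(e)}$; (4) $p_v=\sum_{s(e)=v}s_es_e^*$ whenever $0<|s^{-1}(v)|<\infty$. Permutative representation: given $\pi:C^*(\mathcal{G})\to B(H)$, let $H_e=\pi(s_es_e^* )(H)$ for $e\in\mathcal{G}^1$ and $H_A=\pi(p_A)(H)$ for $A\in\mathcal{G}^0$. $\pi$ is permutative if there exist orthonormal bases $B$ of $H$, $B_v$ of $H_v$ ($v\in G^0$), $B_{r(e)}$ of $H_{r(e)}$ and $B_e$ of $H_e$ ($e\in\mathcal{G}^1$) such that: (1) $B_{r(e)}\subset B$ for all $e\in\mathcal{G}^1$ and $B_v\subseteq B$ for all $v\in G^0$; (2) $B_v\subset B_{r(e)}$ whenever $v\in r(e)$; (3) $B_v\supset\bigcup_{e\in s^{-1}(v)}B_e$ for all $v\in G^0$; (4) $\pi(s_e)(B_{r(e)})=B_e$ for all $e\in\mathcal{G}^1$. $\mathcal{G}$-branching system on $(X,\mu)$: measurable subsets $\{R_e,D_A\}_{e\in\mathcal{G}^1,A\in\mathcal{G}^0}$ of $X$ with, up to $\mu$-null sets: (1) $R_e\cap R_f=\emptyset$ if $e\ne f$; (2) $D_\emptyset=\emptyset$ (exactly), $D_A\cap D_B=D_{A\cap B}$, $D_A\cup D_B=D_{A\cup B}$; (3) $R_e\subseteq D_{s(e)}$; (4) $D_v=\bigcup_{e\in s^{-1}(v)}R_e$ if $0<|s^{-1}(v)|<\infty$; and (5) for each $e$, measurable maps $f_e:D_{r(e)}\to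 R_e$ and $f_e^{-1}:R_e\to D_{r(e)}$ with $f_e\circ f_e^{-1}=\mathrm{id}_{R_e}$ and $f_e^{-1}\circ f_e=\mathrm{id}_{D_{r(e)}}$ $\mu$-a.e., such that the pushforward measure $\mu\circ f_e$ on $D_{r(e)}$ (pushforward of $\mu|_{R_e}$ under $f_e^{-1}$) is absolutely continuous with respect to $\mu$ on $D_{r(e)}$, and the pushforward measure $\mu\circ f_e^{-1}$ on $R_e$ (pushforward of $\mu|_{D_{r(e)}}$ under $f_e$) is absolutely continuous with respect to $\mu$ on $R_e$. Write $\Phi_{f_e}=d(\mu\circ f_e)/d\mu$ and $\Phi_{f_e^{-1}}=d(\mu\circ f_e^{-1})/d\mu$ for the Radon-Nikodym derivatives. The representation induced from such a branching system is the unique representation $\rho:C^*(\mathcal{G})\to B(\mathcal{L}^2(X,\mu))$ with $\rho(s_e)(\phi)=\Phi_{f_e^{-1}}^{1/2}\cdot(\phi\circ f_e^{-1})$ (extended by zero outside $R_e$) and $\rho(p_A)(\phi)=\chi_{D_A}\phi$. *)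

theory Defs
  imports "HOL-Analysis.Analysis" "HOL-Algebra.Module"
begin

section \<open>Complex Hilbert spaces\<close>

class chilbert_space = real_inner + complete_space +
  fixes scaleC :: "complex \<Rightarrow> 'a \<Rightarrow> 'a" (infixr \<open>*\<^sub>C\<close> 75)
    and cinner :: "'a \<Rightarrow> 'a \<Rightarrow> complex"
  assumes scaleC_add_right: "a *\<^sub>C (x + y) = a *\<^sub>C x + a *\<^sub>C y"
    and scaleC_add_left: "(a + b) *\<^sub>C x = a *\<^sub>C x + b *\<^sub>C x"
    and scaleC_scaleC: "a *\<^sub>C b *\<^sub>C x = (a * b) *\<^sub>C x"
    and scaleR_scaleC: "r *\<^sub>R x = complex_of_real r *\<^sub>C x"
    and cinner_commute: "cinner x y = cnj (cinner y x)"
    and cinner_add_left: "cinner (x + y) z = cinner x z + cinner y z"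
    and cinner_scaleC_left: "cinner (a *\<^sub>C x) y = a * cinner x y"
    and inner_eq_Re_cinner: "inner x y = Re (cinner x y)"

global_interpretation complex_vector: vector_space "scaleC :: complex \<Rightarrow> 'a \<Rightarrow> 'a::chilbert_space"
  defines cspan = complex_vector.span
proof
  fix x :: 'a
  show "1 *\<^sub>C x = x"
    using scaleR_scaleC[of 1 x] by simp
qed (auto simp: scaleC_add_right scaleC_add_left scaleC_scaleC)

definition bounded_clinear :: "('a::chilbert_space \<Rightarrow> 'b::chilbert_space) \<Rightarrow> bool" where
  "bounded_clinear T \<longleftrightarrow> bounded_linear T \<and> (\<forall>c x. T (c *\<^sub>C x) = c *\<^sub>C T x)"

definition unitary_op :: "('a::chilbert_space \<Rightarrow> 'b::chilbert_space) \<Rightarrow> bool" where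
  "unitary_op U \<longleftrightarrow> bounded_clinear U \<and> bij U \<and> (\<forall>x y. cinner (U x) (U y) = cinner x y)"

definition separable_hilbert :: "'h::chilbert_space itself \<Rightarrow> bool" where
  "separable_hilbert _ \<longleftrightarrow> separable_space (euclidean :: 'h topology)"

definition infinite_dimensional :: "'h::chilbert_space itself \<Rightarrow> bool" where
  "infinite_dimensional _ \<longleftrightarrow> \<not> (\<exists>F :: 'h set. finite F \<and> cspan F = UNIV)"

definition orthonormal_basis_of :: "'h::chilbert_space set \<Rightarrow> 'h set \<Rightarrow> bool" where
  "orthonormal_basis_of B K \<longleftrightarrow>
     (\<forall>b\<in>B. \<forall>c\<in>B. cinner b c = (if b = c then 1 else 0)) \<and> closure (cspan B) = K"


section \<open>The Hilbert space of square summable sequences\<close>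

text \<open>The index set, the positive integers, is relabelled as \<open>nat\<close>.\<close>

typedef ell2 = "{x :: nat \<Rightarrow> complex. summable (\<lambda>n. (cmod (x n))\<^sup>2)}"
  morphisms coord Abs_ell2
  by (rule exI[of _ "\<lambda>_. 0"]) simp

setup_lifting type_definition_ell2

lemma summable_coord: "summable (\<lambda>n. (cmod (coord x n))\<^sup>2)"
  using coord[of x] by simp

lemma coord_eqI: "(\<And>n. coord x n = coord y n) \<Longrightarrow> x = y"
  by (intro iffD1[OF coord_inject] ext)

lemma square_summable_add:
  fixes x y :: "nat \<Rightarrow> complex"
  assumes "summable (\<lambda>n. (cmod (x n))\<^sup>2)" "summable (\<lambda>n. (cmod (y n))\<^sup>2)"
  shows "summable (\<lambda>n. (cmod (x n + y n))\<^sup>2)"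
proof (rule summable_comparison_test')
  show "summable (\<lambda>n. 2 * (cmod (x n))\<^sup>2 + 2 * (cmod (y n))\<^sup>2)"
    using assms by (intro summable_add summable_mult)
  fix n
  have "(cmod (x n + y n))\<^sup>2 \<le> (cmod (x n) + cmod (y n))\<^sup>2"
    by (intro power_mono norm_triangle_ineq) auto
  also have "\<dots> \<le> 2 * (cmod (x n))\<^sup>2 + 2 * (cmod (y n))\<^sup>2"
    using sum_squares_bound[of "cmod (x n)" "cmod (y n)"] by (simp add: power2_sum)
  finally show "norm ((cmod (x n + y n))\<^sup>2) \<le> 2 * (cmod (x n))\<^sup>2 + 2 * (cmod (y n))\<^sup>2"
    by simp
qed

lemma square_summable_scale:
  fixes x :: "nat \<Rightarrow> complex"
  assumes "summable (\<lambda>n. (cmod (x n))\<^sup>2)"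
  shows "summable (\<lambda>n. (cmod (c * x n))\<^sup>2)"
  using summable_mult[OF assms, of "(cmod c)\<^sup>2"] by (simp add: norm_mult power_mult_distrib)

lemma summable_cinner: "summable (\<lambda>n. coord x n * cnj (coord y n))"
proof (rule summable_comparison_test')
  show "summable (\<lambda>n. (cmod (coord x n))\<^sup>2 + (cmod (coord y n))\<^sup>2)"
    by (intro summable_add summable_coord)
  fix n
  have "cmod (coord x n) * cmod (coord y n) \<le> 2 * cmod (coord x n) * cmod (coord y n)"
    by simp
  also have "\<dots> \<le> (cmod (coord x n))\<^sup>2 + (cmod (coord y n))\<^sup>2"
    by (rule sum_squares_bound)
  finally show "norm (coord x n * cnj (coord y n)) \<le> (cmod (coord x n))\<^sup>2 + (cmod (coord y n))\<^sup>2"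
    by (simp add: norm_mult)
qed

instantiation ell2 :: real_inner
begin

lift_definition zero_ell2 :: ell2 is "\<lambda>_. 0" by simp
lift_definition plus_ell2 :: "ell2 \<Rightarrow> ell2 \<Rightarrow> ell2" is "\<lambda>x y n. x n + y n"
  by (rule square_summable_add)
lift_definition uminus_ell2 :: "ell2 \<Rightarrow> ell2" is "\<lambda>x n. - x n" by simp
lift_definition minus_ell2 :: "ell2 \<Rightarrow> ell2 \<Rightarrow> ell2" is "\<lambda>x y n. x n - y n"
  subgoal for x y using square_summable_add[of x "\<lambda>n. - y n"] by simp
  done
lift_definition scaleR_ell2 :: "real \<Rightarrow> ell2 \<Rightarrow> ell2" is "\<lambda>r x n. complex_of_real r * x n"
  by (rule square_summable_scale)

definition inner_ell2 :: "ell2 \<Rightarrow> ell2 \<Rightarrow> real" where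
  "inner_ell2 x y = Re (\<Sum>n. coord x n * cnj (coord y n))"
definition norm_ell2 :: "ell2 \<Rightarrow> real" where
  "norm_ell2 x = sqrt (\<Sum>n. (cmod (coord x n))\<^sup>2)"
definition sgn_ell2 :: "ell2 \<Rightarrow> ell2" where
  "sgn_ell2 x = inverse (norm x) *\<^sub>R x"
definition dist_ell2 :: "ell2 \<Rightarrow> ell2 \<Rightarrow> real" where
  "dist_ell2 x y = norm (x - y)"
definition uniformity_ell2 :: "(ell2 \<times> ell2) filter" where
  "uniformity_ell2 = (INF e\<in>{0<..}. principal {(x, y). dist x y < e})"
definition open_ell2 :: "ell2 set \<Rightarrow> bool" where
  "open_ell2 U \<longleftrightarrow> (\<forall>x\<in>U. eventually (\<lambda>(x', y). x' = x \<longrightarrow> y \<in> U) uniformity)"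

lemma inner_ell2_self: "inner x x = (\<Sum>n. (cmod (coord x n))\<^sup>2)" for x :: ell2
proof -
  have "(\<Sum>n. coord x n * cnj (coord x n)) = (\<Sum>n. complex_of_real ((cmod (coord x n))\<^sup>2))"
    by (simp only: complex_norm_square)
  also have "\<dots> = complex_of_real (\<Sum>n. (cmod (coord x n))\<^sup>2)"
    by (rule suminf_of_real[OF summable_coord, symmetric])
  finally show ?thesis by (simp add: inner_ell2_def)
qed

instance
proof
  fix x y z :: ell2 and r t :: real
  show "x + y + z = x + (y + z)"
    by transfer (simp add: add.assoc)
  show "x + y = y + x"
    by transfer (simp add: add.commute)
  show "0 + x = x"
    by transfer simp
  show "- x + x = 0"
    by transfer simp
  show "x - y = x + - y"
    by transfer simp
  show "r *\<^sub>R (x + y) = r *\<^sub>R x + r *\<^sub>R y"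
    by transfer (simp add: distrib_left)
  show "(r + t) *\<^sub>R x = r *\<^sub>R x + t *\<^sub>R x"
    by transfer (simp add: distrib_right)
  show "r *\<^sub>R t *\<^sub>R x = (r * t) *\<^sub>R x"
    by transfer (simp add: mult.assoc)
  show "1 *\<^sub>R x = x"
    by transfer simp
  show "sgn x = inverse (norm x) *\<^sub>R x"
    by (rule sgn_ell2_def)
  show "dist x y = norm (x - y)"
    by (rule dist_ell2_def)
  show "uniformity = (INF e\<in>{0<..}. principal {(x, y :: ell2). dist x y < e})"
    by (rule uniformity_ell2_def)
  show "open U \<longleftrightarrow> (\<forall>x\<in>U. eventually (\<lambda>(x', y). x' = x \<longrightarrow> y \<in> U) uniformity)" for U :: "ell2 set"
    by (rule open_ell2_def)
  show "inner x y = inner y x"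
    unfolding inner_ell2_def Re_suminf[OF summable_cinner] by (simp add: mult.commute)
  show "inner (x + y) z = inner x z + inner y z"
    unfolding inner_ell2_def
    by (simp add: suminf_add[OF summable_cinner summable_cinner, symmetric] plus_ell2.rep_eq distrib_right)
  show "inner (r *\<^sub>R x) y = r * inner x y"
    unfolding inner_ell2_def
    by (simp add: suminf_mult[OF summable_cinner] scaleR_ell2.rep_eq mult.assoc)
  show "0 \<le> inner x x"
    by (simp add: inner_ell2_self suminf_nonneg summable_coord)
  show "inner x x = 0 \<longleftrightarrow> x = 0"
  proof
    assume "inner x x = 0"
    then have "(cmod (coord x n))\<^sup>2 = 0" for n
      using suminf_eq_zero_iff[OF summable_coord[of x]] by (simp add: inner_ell2_self)
    then show "x = 0"
      by (intro coord_eqI) (simp add: zero_ell2.rep_eq)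
  qed (simp add: inner_ell2_self zero_ell2.rep_eq)
  show "norm x = sqrt (inner x x)"
    by (simp add: norm_ell2_def inner_ell2_self)
qed

end

instance ell2 :: complete_space
proof
  fix X :: "nat \<Rightarrow> ell2"
  assume "Cauchy X"
  then have cau: "\<exists>M. \<forall>m\<ge>M. \<forall>n\<ge>M. norm (X m - X n) < e" if "e > 0" for e
    using metric_CauchyD[OF \<open>Cauchy X\<close> that] by (simp add: dist_norm)
  have part: "(\<Sum>i<N. (cmod (coord x i))\<^sup>2) \<le> (norm x)\<^sup>2" for x :: ell2 and N
    using sum_le_suminf[OF summable_coord[of x], of "{..<N}"]
    by (simp add: norm_ell2_def suminf_nonneg summable_coord)
  have le: "cmod (coord x i) \<le> norm x" for x :: ell2 and i
  proof (rule power2_le_imp_le)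
    have "(cmod (coord x i))\<^sup>2 \<le> (\<Sum>j<Suc i. (cmod (coord x j))\<^sup>2)"
      by (intro member_le_sum) auto
    also have "\<dots> \<le> (norm x)\<^sup>2" by (rule part)
    finally show "(cmod (coord x i))\<^sup>2 \<le> (norm x)\<^sup>2" .
    show "0 \<le> norm x"
      by (simp add: norm_ell2_def suminf_nonneg summable_coord)
  qed
  have "Cauchy (\<lambda>k. coord (X k) i)" for i
  proof (rule CauchyI)
    fix e :: real assume "0 < e"
    then obtain M where M: "norm (X m - X n) < e" if "m \<ge> M" "n \<ge> M" for m n
      using cau by blast
    show "\<exists>M. \<forall>m\<ge>M. \<forall>n\<ge>M. norm (coord (X m) i - coord (X n) i) < e"
      using M le[of "X _ - X _" i] by (metis le_less_trans minus_ell2.rep_eq)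
  qed
  then have "\<forall>i. \<exists>l. (\<lambda>k. coord (X k) i) \<longlonglongrightarrow> l"
    using Cauchy_convergent_iff convergent_def by blast
  then obtain l where l: "(\<lambda>k. coord (X k) i) \<longlonglongrightarrow> l i" for i
    by metis
  have bound: "\<exists>M. \<forall>k\<ge>M. \<forall>N. (\<Sum>i<N. (cmod (coord (X k) i - l i))\<^sup>2) \<le> e\<^sup>2" if e: "e > 0" for e
  proof -
    obtain M where M: "norm (X m - X n) < e" if "m \<ge> M" "n \<ge> M" for m n
      using cau[OF e] by blast
    have "(\<Sum>i<N. (cmod (coord (X k) i - l i))\<^sup>2) \<le> e\<^sup>2" if k: "k \<ge> M" for k N
    proof (rule LIMSEQ_le_const2)
      show "(\<lambda>m. \<Sum>i<N. (cmod (coord (X k) i - coord (X m) i))\<^sup>2)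
              \<longlonglongrightarrow> (\<Sum>i<N. (cmod (coord (X k) i - l i))\<^sup>2)"
        by (intro tendsto_intros l)
      have "(\<Sum>i<N. (cmod (coord (X k) i - coord (X m) i))\<^sup>2) \<le> e\<^sup>2" if m: "m \<ge> M" for m
      proof -
        have "(\<Sum>i<N. (cmod (coord (X k) i - coord (X m) i))\<^sup>2) \<le> (norm (X k - X m))\<^sup>2"
          using part[of "X k - X m" N] by (simp add: minus_ell2.rep_eq)
        also have "\<dots> \<le> e\<^sup>2"
          using M[OF k m] by (intro power_mono) (auto simp: norm_ell2_def suminf_nonneg summable_coord)
        finally show ?thesis .
      qed
      then show "\<exists>M. \<forall>m\<ge>M. (\<Sum>i<N. (cmod (coord (X k) i - coord (X m) i))\<^sup>2) \<le> e\<^sup>2"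
        by blast
    qed
    then show ?thesis by blast
  qed
  have sums: "summable (\<lambda>i. (cmod (coord (X k) i - l i))\<^sup>2)"
    if "\<forall>N. (\<Sum>i<N. (cmod (coord (X k) i - l i))\<^sup>2) \<le> e\<^sup>2" for k e
    by (rule summableI_nonneg_bounded[where x = "e\<^sup>2"]) (use that in auto)
  obtain K where K: "\<forall>N. (\<Sum>i<N. (cmod (coord (X K) i - l i))\<^sup>2) \<le> 1\<^sup>2"
    using bound[of 1] by auto
  have "summable (\<lambda>i. (cmod (l i))\<^sup>2)"
    using square_summable_add[OF summable_coord[of "X K"], of "\<lambda>i. - (coord (X K) i - l i)"] sums[OF K]
    by (simp add: norm_minus_commute)
  then have L: "coord (Abs_ell2 l) = l"
    by (simp add: Abs_ell2_inverse)
  have "X \<longlonglongrightarrow> Abs_ell2 l"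
  proof (rule metric_LIMSEQ_I)
    fix r :: real assume r: "0 < r"
    obtain M where M: "\<forall>k\<ge>M. \<forall>N. (\<Sum>i<N. (cmod (coord (X k) i - l i))\<^sup>2) \<le> (r / 2)\<^sup>2"
      using bound[of "r / 2"] r by auto
    have "dist (X k) (Abs_ell2 l) < r" if k: "k \<ge> M" for k
    proof -
      have "(\<Sum>i. (cmod (coord (X k) i - l i))\<^sup>2) \<le> (r / 2)\<^sup>2"
        using M k sums[of k "r / 2"] by (intro suminf_le_const) auto
      then have "dist (X k) (Abs_ell2 l) \<le> sqrt ((r / 2)\<^sup>2)"
        unfolding dist_norm norm_ell2_def minus_ell2.rep_eq L by (rule real_sqrt_le_mono)
      then show ?thesis using r by simp
    qed
    then show "\<exists>M. \<forall>k\<ge>M. dist (X k) (Abs_ell2 l) < r" by blast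
  qed
  then show "convergent X"
    by (rule convergentI)
qed

instantiation ell2 :: chilbert_space
begin

lift_definition scaleC_ell2 :: "complex \<Rightarrow> ell2 \<Rightarrow> ell2" is "\<lambda>c x n. c * x n"
  by (rule square_summable_scale)

definition cinner_ell2 :: "ell2 \<Rightarrow> ell2 \<Rightarrow> complex" where
  "cinner_ell2 x y = (\<Sum>n. coord x n * cnj (coord y n))"

instance
proof
  fix x y z :: ell2 and a b :: complex and r :: real
  show "a *\<^sub>C (x + y) = a *\<^sub>C x + a *\<^sub>C y"
    by transfer (simp add: distrib_left)
  show "(a + b) *\<^sub>C x = a *\<^sub>C x + b *\<^sub>C x"
    by transfer (simp add: distrib_right)
  show "a *\<^sub>C b *\<^sub>C x = (a * b) *\<^sub>C x"
    by transfer (simp add: mult.assoc)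
  show "r *\<^sub>R x = complex_of_real r *\<^sub>C x"
    by transfer simp
  show "cinner x y = cnj (cinner y x)"
    unfolding cinner_ell2_def
    using bounded_linear.suminf[OF bounded_linear_cnj summable_cinner[of y x]]
    by (simp add: mult.commute)
  show "cinner (x + y) z = cinner x z + cinner y z"
    unfolding cinner_ell2_def
    by (simp add: suminf_add[OF summable_cinner summable_cinner] plus_ell2.rep_eq distrib_right)
  show "cinner (a *\<^sub>C x) y = a * cinner x y"
    unfolding cinner_ell2_def
    by (simp add: suminf_mult[OF summable_cinner] scaleC_ell2.rep_eq mult.assoc)
  show "inner x y = Re (cinner x y)"
    by (simp add: inner_ell2_def cinner_ell2_def)
qed

end


section \<open>C*-algebras\<close>

text \<open>C*-algebras need not be unital: the field \<open>one\<close> inherited from the record of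
  rings is left unconstrained and never used.\<close>

record 'a cstar = "(complex, 'a) module" +
  star :: "'a \<Rightarrow> 'a"
  nrm :: "'a \<Rightarrow> real"

locale cstar_algebra = abelian_group A for A :: "'a cstar" (structure) +
  assumes m_closed: "\<lbrakk>x \<in> carrier A; y \<in> carrier A\<rbrakk> \<Longrightarrow> x \<otimes> y \<in> carrier A"
    and m_assoc: "\<lbrakk>x \<in> carrier A; y \<in> carrier A; z \<in> carrier A\<rbrakk>
      \<Longrightarrow> (x \<otimes> y) \<otimes> z = x \<otimes> (y \<otimes> z)"
    and l_distr: "\<lbrakk>x \<in> carrier A; y \<in> carrier A; z \<in> carrier A\<rbrakk>
      \<Longrightarrow> (x \<oplus> y) \<otimes> z = x \<otimes> z \<oplus> y \<otimes> z"
    and r_distr: "\<lbrakk>x \<in> carrier A; y \<in> carrier A; z \<in> carrier A\<rbrakk>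
      \<Longrightarrow> z \<otimes> (x \<oplus> y) = z \<otimes> x \<oplus> z \<otimes> y"
    and smult_closed: "x \<in> carrier A \<Longrightarrow> c \<odot> x \<in> carrier A"
    and smult_l_distr: "x \<in> carrier A \<Longrightarrow> (c + d) \<odot> x = c \<odot> x \<oplus> d \<odot> x"
    and smult_r_distr: "\<lbrakk>x \<in> carrier A; y \<in> carrier A\<rbrakk> \<Longrightarrow> c \<odot> (x \<oplus> y) = c \<odot> x \<oplus> c \<odot> y"
    and smult_assoc: "x \<in> carrier A \<Longrightarrow> (c * d) \<odot> x = c \<odot> (d \<odot> x)"
    and smult_one: "x \<in> carrier A \<Longrightarrow> 1 \<odot> x = x"
    and smult_mult_l: "\<lbrakk>x \<in> carrier A; y \<in> carrier A\<rbrakk> \<Longrightarrow> (c \<odot> x) \<otimes> y = c \<odot> (x \<otimes> y)"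
    and smult_mult_r: "\<lbrakk>x \<in> carrier A; y \<in> carrier A\<rbrakk> \<Longrightarrow> x \<otimes> (c \<odot> y) = c \<odot> (x \<otimes> y)"
    and star_closed: "x \<in> carrier A \<Longrightarrow> star A x \<in> carrier A"
    and star_star: "x \<in> carrier A \<Longrightarrow> star A (star A x) = x"
    and star_add: "\<lbrakk>x \<in> carrier A; y \<in> carrier A\<rbrakk> \<Longrightarrow> star A (x \<oplus> y) = star A x \<oplus> star A y"
    and star_smult: "x \<in> carrier A \<Longrightarrow> star A (c \<odot> x) = cnj c \<odot> star A x"
    and star_mult: "\<lbrakk>x \<in> carrier A; y \<in> carrier A\<rbrakk> \<Longrightarrow> star A (x \<otimes> y) = star A y \<otimes> star A x"
    and nrm_nonneg: "x \<in> carrier A \<Longrightarrow> 0 \<le> nrm A x"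
    and nrm_eq_0_iff: "x \<in> carrier A \<Longrightarrow> nrm A x = 0 \<longleftrightarrow> x = \<zero>"
    and nrm_triangle: "\<lbrakk>x \<in> carrier A; y \<in> carrier A\<rbrakk> \<Longrightarrow> nrm A (x \<oplus> y) \<le> nrm A x + nrm A y"
    and nrm_smult: "x \<in> carrier A \<Longrightarrow> nrm A (c \<odot> x) = cmod c * nrm A x"
    and nrm_mult: "\<lbrakk>x \<in> carrier A; y \<in> carrier A\<rbrakk> \<Longrightarrow> nrm A (x \<otimes> y) \<le> nrm A x * nrm A y"
    and nrm_star_mult: "x \<in> carrier A \<Longrightarrow> nrm A (star A x \<otimes> x) = (nrm A x)\<^sup>2"
    and nrm_complete: "\<lbrakk>\<And>n. u n \<in> carrier A;
        \<And>e. e > 0 \<Longrightarrow> \<exists>N. \<forall>m\<ge>N. \<forall>n\<ge>N. nrm A (u m \<ominus> u n) < e\<rbrakk>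
      \<Longrightarrow> \<exists>x\<in>carrier A. (\<lambda>n. nrm A (u n \<ominus> x)) \<longlonglongrightarrow> 0"

definition cstar_le :: "'a cstar \<Rightarrow> 'a \<Rightarrow> 'a \<Rightarrow> bool" where
  "cstar_le A x y \<longleftrightarrow> (\<exists>c\<in>carrier A. y \<ominus>\<^bsub>A\<^esub> x = star A c \<otimes>\<^bsub>A\<^esub> c)"

definition is_projection :: "'a cstar \<Rightarrow> 'a \<Rightarrow> bool" where
  "is_projection A q \<longleftrightarrow> q \<in> carrier A \<and> star A q = q \<and> q \<otimes>\<^bsub>A\<^esub> q = q"

definition is_partial_isometry :: "'a cstar \<Rightarrow> 'a \<Rightarrow> bool" where
  "is_partial_isometry A w \<longleftrightarrow> w \<in> carrier A \<and> w \<otimes>\<^bsub>A\<^esub> star A w \<otimes>\<^bsub>A\<^esub> w = w"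

definition star_hom :: "'a cstar \<Rightarrow> 'b cstar \<Rightarrow> ('a \<Rightarrow> 'b) \<Rightarrow> bool" where
  "star_hom A B h \<longleftrightarrow>
     (\<forall>x\<in>carrier A. h x \<in> carrier B \<and> h (star A x) = star B (h x)) \<and>
     (\<forall>x\<in>carrier A. \<forall>c. h (c \<odot>\<^bsub>A\<^esub> x) = c \<odot>\<^bsub>B\<^esub> h x) \<and>
     (\<forall>x\<in>carrier A. \<forall>y\<in>carrier A.
        h (x \<oplus>\<^bsub>A\<^esub> y) = h x \<oplus>\<^bsub>B\<^esub> h y \<and> h (x \<otimes>\<^bsub>A\<^esub> y) = h x \<otimes>\<^bsub>B\<^esub> h y)"

definition cstar_subalgebra :: "'a cstar \<Rightarrow> 'a set \<Rightarrow> bool" where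
  "cstar_subalgebra A S \<longleftrightarrow>
     S \<subseteq> carrier A \<and> \<zero>\<^bsub>A\<^esub> \<in> S \<and>
     (\<forall>x\<in>S. star A x \<in> S \<and> (\<forall>c. c \<odot>\<^bsub>A\<^esub> x \<in> S)) \<and>
     (\<forall>x\<in>S. \<forall>y\<in>S. x \<oplus>\<^bsub>A\<^esub> y \<in> S \<and> x \<otimes>\<^bsub>A\<^esub> y \<in> S) \<and>
     (\<forall>u. \<forall>x\<in>carrier A. (\<forall>n. u n \<in> S) \<and> (\<lambda>n. nrm A (u n \<ominus>\<^bsub>A\<^esub> x)) \<longlonglongrightarrow> 0 \<longrightarrow> x \<in> S)"

definition generates_cstar :: "'a cstar \<Rightarrow> 'a set \<Rightarrow> bool" where
  "generates_cstar A X \<longleftrightarrow> (\<forall>S. cstar_subalgebra A S \<and> X \<subseteq> S \<longrightarrow> S = carrier A)"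


section \<open>Ultragraphs and their C*-algebras\<close>

record ('v, 'e) ultragraph_data =
  verts :: "'v set"
  edges :: "'e set"
  rng :: "'e \<Rightarrow> 'v set"
  src :: "'e \<Rightarrow> 'v"

definition ultragraph :: "('v, 'e) ultragraph_data \<Rightarrow> bool" where
  "ultragraph G \<longleftrightarrow>
     countable (verts G) \<and> countable (edges G) \<and>
     (\<forall>e\<in>edges G. src G e \<in> verts G \<and> rng G e \<subseteq> verts G \<and> rng G e \<noteq> {})"

inductive_set gen_verts :: "('v, 'e) ultragraph_data \<Rightarrow> 'v set set" for G where
  empty: "{} \<in> gen_verts G"
| singleton: "v \<in> verts G \<Longrightarrow> {v} \<in> gen_verts G"
| range: "e \<in> edges G \<Longrightarrow> rng G e \<in> gen_verts G"
| union: "X \<in> gen_verts G \<Longrightarrow> Y \<in> gen_verts G \<Longrightarrow> X \<union> Y \<in> gen_verts G"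
| inter: "X \<in> gen_verts G \<Longrightarrow> Y \<in> gen_verts G \<Longrightarrow> X \<inter> Y \<in> gen_verts G"

definition out_edges :: "('v, 'e) ultragraph_data \<Rightarrow> 'v \<Rightarrow> 'e set" where
  "out_edges G v = {e \<in> edges G. src G e = v}"

definition ultragraph_family ::
  "('v, 'e) ultragraph_data \<Rightarrow> 'a cstar \<Rightarrow> ('e \<Rightarrow> 'a) \<Rightarrow> ('v set \<Rightarrow> 'a) \<Rightarrow> bool" where
  "ultragraph_family G A s p \<longleftrightarrow>
     (\<forall>e\<in>edges G. is_partial_isometry A (s e)) \<and>
     (\<forall>e\<in>edges G. \<forall>f\<in>edges G. e \<noteq> f \<longrightarrow>
        (s e \<otimes>\<^bsub>A\<^esub> star A (s e)) \<otimes>\<^bsub>A\<^esub> (s f \<otimes>\<^bsub>A\<^esub> star A (s f)) = \<zero>\<^bsub>A\<^esub>) \<and>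
     (\<forall>X\<in>gen_verts G. is_projection A (p X)) \<and>
     p {} = \<zero>\<^bsub>A\<^esub> \<and>
     (\<forall>X\<in>gen_verts G. \<forall>Y\<in>gen_verts G.
        p X \<otimes>\<^bsub>A\<^esub> p Y = p (X \<inter> Y) \<and>
        p (X \<union> Y) = p X \<oplus>\<^bsub>A\<^esub> p Y \<ominus>\<^bsub>A\<^esub> p (X \<inter> Y)) \<and>
     (\<forall>e\<in>edges G. star A (s e) \<otimes>\<^bsub>A\<^esub> s e = p (rng G e)) \<and>
     (\<forall>e\<in>edges G. cstar_le A (s e \<otimes>\<^bsub>A\<^esub> star A (s e)) (p {src G e})) \<and>
     (\<forall>v\<in>verts G. out_edges G v \<noteq> {} \<and> finite (out_edges G v) \<longrightarrow>
        p {v} = (\<Oplus>\<^bsub>A\<^esub>e\<in>out_edges G v. s e \<otimes>\<^bsub>A\<^esub> star A (s e)))"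

text \<open>\<open>A\<close> with generators \<open>s\<close>, \<open>p\<close> is the universal C*-algebra of \<open>G\<close>. HOL cannot quantify
  over all carrier types, so the C*-algebras \<open>B\<close> tested range over those carried by a set
  of reals. This is the full universal property: the C*-subalgebra generated by the countable family
  \<open>S\<close>, \<open>P\<close> in any C*-algebra is separable, so has at most the cardinality of the continuum,
  and is isomorphic to one carried by a set of reals.\<close>

definition universal_cstar_algebra ::
  "('v, 'e) ultragraph_data \<Rightarrow> 'a cstar \<Rightarrow> ('e \<Rightarrow> 'a) \<Rightarrow> ('v set \<Rightarrow> 'a) \<Rightarrow> bool" where
  "universal_cstar_algebra G A s p \<longleftrightarrow>
     cstar_algebra A \<and> ultragraph_family G A s p \<and>
     generates_cstar A (s ` edges G \<union> p ` gen_verts G) \<and>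
     (\<forall>(B :: real cstar) S P. cstar_algebra B \<and> ultragraph_family G B S P \<longrightarrow>
        (\<exists>h. star_hom A B h \<and> (\<forall>e\<in>edges G. h (s e) = S e) \<and> (\<forall>X\<in>gen_verts G. h (p X) = P X)))"


section \<open>Representations\<close>

definition representation :: "'a cstar \<Rightarrow> ('a \<Rightarrow> 'h \<Rightarrow> 'h::chilbert_space) \<Rightarrow> bool" where
  "representation A \<pi> \<longleftrightarrow>
     (\<forall>a\<in>carrier A. bounded_clinear (\<pi> a)) \<and>
     (\<forall>a\<in>carrier A. \<forall>b\<in>carrier A. \<forall>x. \<pi> (a \<oplus>\<^bsub>A\<^esub> b) x = \<pi> a x + \<pi> b x) \<and>
     (\<forall>a\<in>carrier A. \<forall>c x. \<pi> (c \<odot>\<^bsub>A\<^esub> a) x = c *\<^sub>C \<pi> a x) \<and>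
     (\<forall>a\<in>carrier A. \<forall>b\<in>carrier A. \<forall>x. \<pi> (a \<otimes>\<^bsub>A\<^esub> b) x = \<pi> a (\<pi> b x)) \<and>
     (\<forall>a\<in>carrier A. \<forall>x y. cinner (\<pi> a x) y = cinner x (\<pi> (star A a) y))"

definition unitarily_equivalent ::
  "'a cstar \<Rightarrow> ('a \<Rightarrow> 'h \<Rightarrow> 'h::chilbert_space) \<Rightarrow> ('a \<Rightarrow> 'k \<Rightarrow> 'k::chilbert_space) \<Rightarrow> bool" where
  "unitarily_equivalent A \<pi> \<rho> \<longleftrightarrow>
     (\<exists>U. unitary_op U \<and> (\<forall>a\<in>carrier A. \<forall>x. U (\<pi> a x) = \<rho> a (U x)))"

text \<open>The bases \<open>B\<^sub>v\<close> and \<open>B\<^sub>r\<^sub>(\<^sub>e\<^sub>)\<close> form one family \<open>BV\<close> indexed by subsets of \<open>verts G\<close>, a vertex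
  \<open>v\<close> being identified with \<open>{v}\<close>. Inclusions are not required to be proper.\<close>

definition permutative_basis ::
  "('v, 'e) ultragraph_data \<Rightarrow> 'a cstar \<Rightarrow> ('e \<Rightarrow> 'a) \<Rightarrow> ('v set \<Rightarrow> 'a)
     \<Rightarrow> ('a \<Rightarrow> 'h \<Rightarrow> 'h::chilbert_space) \<Rightarrow> 'h set \<Rightarrow> bool" where
  "permutative_basis G A s p \<pi> B \<longleftrightarrow>
     orthonormal_basis_of B UNIV \<and>
     (\<exists>BV BE.
        (\<forall>v\<in>verts G. orthonormal_basis_of (BV {v}) (range (\<pi> (p {v})))) \<and>
        (\<forall>e\<in>edges G. orthonormal_basis_of (BV (rng G e)) (range (\<pi> (p (rng G e))))) \<and>
        (\<forall>e\<in>edges G. orthonormal_basis_of (BE e) (range (\<pi> (s e \<otimes>\<^bsub>A\<^esub> star A (s e))))) \<and>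
        (\<forall>e\<in>edges G. BV (rng G e) \<subseteq> B) \<and> (\<forall>v\<in>verts G. BV {v} \<subseteq> B) \<and>
        (\<forall>e\<in>edges G. \<forall>v\<in>rng G e. BV {v} \<subseteq> BV (rng G e)) \<and>
        (\<forall>v\<in>verts G. (\<Union>e\<in>out_edges G v. BE e) \<subseteq> BV {v}) \<and>
        (\<forall>e\<in>edges G. \<pi> (s e) ` BV (rng G e) = BE e))"

definition permutative ::
  "('v, 'e) ultragraph_data \<Rightarrow> 'a cstar \<Rightarrow> ('e \<Rightarrow> 'a) \<Rightarrow> ('v set \<Rightarrow> 'a)
     \<Rightarrow> ('a \<Rightarrow> 'h \<Rightarrow> 'h::chilbert_space) \<Rightarrow> bool" where
  "permutative G A s p \<pi> \<longleftrightarrow> representation A \<pi> \<and> (\<exists>B. permutative_basis G A s p \<pi> B)"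


section \<open>Branching systems\<close>

text \<open>\<open>f e\<close> maps \<open>D (rng G e)\<close> to \<open>R e\<close>, and \<open>g e\<close> is its almost everywhere inverse.\<close>

definition branching_system ::
  "('v, 'e) ultragraph_data \<Rightarrow> 'x measure \<Rightarrow> ('e \<Rightarrow> 'x set) \<Rightarrow> ('v set \<Rightarrow> 'x set)
     \<Rightarrow> ('e \<Rightarrow> 'x \<Rightarrow> 'x) \<Rightarrow> ('e \<Rightarrow> 'x \<Rightarrow> 'x) \<Rightarrow> bool" where
  "branching_system G M R D f g \<longleftrightarrow>
     sigma_finite_measure M \<and>
     (\<forall>e\<in>edges G. R e \<in> sets M) \<and> (\<forall>X\<in>gen_verts G. D X \<in> sets M) \<and>
     (\<forall>e\<in>edges G. \<forall>e'\<in>edges G. e \<noteq> e' \<longrightarrow> (AE x in M. x \<notin> R e \<inter> R e')) \<and>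
     D {} = {} \<and>
     (\<forall>X\<in>gen_verts G. \<forall>Y\<in>gen_verts G.
        (AE x in M. x \<in> D X \<inter> D Y \<longleftrightarrow> x \<in> D (X \<inter> Y)) \<and>
        (AE x in M. x \<in> D X \<union> D Y \<longleftrightarrow> x \<in> D (X \<union> Y))) \<and>
     (\<forall>e\<in>edges G. AE x in M. x \<in> R e \<longrightarrow> x \<in> D {src G e}) \<and>
     (\<forall>v\<in>verts G. out_edges G v \<noteq> {} \<and> finite (out_edges G v) \<longrightarrow>
        (AE x in M. x \<in> D {v} \<longleftrightarrow> x \<in> (\<Union>e\<in>out_edges G v. R e))) \<and>
     (\<forall>e\<in>edges G.
        let MR = restrict_space M (R e); MD = restrict_space M (D (rng G e)) in
        f e \<in> measurable MD MR \<and> g e \<in> measurable MR MD \<and>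
        (AE x in MR. f e (g e x) = x) \<and> (AE x in MD. g e (f e x) = x) \<and>
        absolutely_continuous MD (distr MR MD (g e)) \<and>
        absolutely_continuous MR (distr MD MR (f e)))"

text \<open>The Radon-Nikodym derivative of the pushforward of \<open>M\<close> restricted to \<open>D (rng G e)\<close> under
  \<open>f e\<close>, with respect to \<open>M\<close> restricted to \<open>R e\<close>.\<close>

definition branching_RN_deriv ::
  "('v, 'e) ultragraph_data \<Rightarrow> 'x measure \<Rightarrow> ('e \<Rightarrow> 'x set) \<Rightarrow> ('v set \<Rightarrow> 'x set)
     \<Rightarrow> ('e \<Rightarrow> 'x \<Rightarrow> 'x) \<Rightarrow> 'e \<Rightarrow> 'x \<Rightarrow> real" where
  "branching_RN_deriv G M R D f e x =
     (let MR = restrict_space M (R e); MD = restrict_space M (D (rng G e))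
      in enn2real (RN_deriv MR (distr MD MR (f e)) x))"

text \<open>The representation induced from a branching system on \<open>nat\<close> with the counting measure.
  Since nonempty sets are not null here, \<open>L\<^sup>2\<close> is \<open>ell2\<close> and the defining formulas hold pointwise.\<close>

definition induced_representation ::
  "('v, 'e) ultragraph_data \<Rightarrow> 'a cstar \<Rightarrow> ('e \<Rightarrow> 'a) \<Rightarrow> ('v set \<Rightarrow> 'a)
     \<Rightarrow> ('e \<Rightarrow> nat set) \<Rightarrow> ('v set \<Rightarrow> nat set) \<Rightarrow> ('e \<Rightarrow> nat \<Rightarrow> nat) \<Rightarrow> ('e \<Rightarrow> nat \<Rightarrow> nat)
     \<Rightarrow> ('a \<Rightarrow> ell2 \<Rightarrow> ell2) \<Rightarrow> bool" where
  "induced_representation G A s p R D f g \<rho> \<longleftrightarrow>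
     branching_system G (count_space UNIV) R D f g \<and> representation A \<rho> \<and>
     (\<forall>e\<in>edges G. \<forall>\<phi> n. coord (\<rho> (s e) \<phi>) n =
        (if n \<in> R e
         then complex_of_real (sqrt (branching_RN_deriv G (count_space UNIV) R D f e n)) * coord \<phi> (g e n)
         else 0)) \<and>
     (\<forall>X\<in>gen_verts G. \<forall>\<phi> n. coord (\<rho> (p X) \<phi>) n = indicator (D X) n * coord \<phi> n)"

end

theory Submission
  imports Defs
begin

text \<open>A permutative basis simultaneously diagonalises all \<open>\<pi> (p\<^sub>A)\<close> and \<open>\<pi> (s\<^sub>e s\<^sub>e\<^sup>*)\<close>, with eigenvalues
  0 and 1, and \<open>\<pi> (s\<^sub>e)\<close> maps the basis vectors it does not kill bijectively onto the basis vectors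
  in its range. Enumerating the basis as \<open>b\<^sub>0, b\<^sub>1, \<dots>\<close> therefore gives subsets \<open>D\<^sub>A\<close>, \<open>R\<^sub>e\<close> of \<open>nat\<close> and
  bijections \<open>f\<^sub>e\<close> that form a branching system with all Radon-Nikodym derivatives equal to 1.
  The unitary sending \<open>x\<close> to its Fourier coefficients conjugates \<open>\<pi>\<close> into the induced representation.\<close>

text \<open>Puts Hilbert spaces under \<open>banach\<close>, so that the Cauchy criterion
  \<open>summable_Cauchy\<close> is available for series of vectors.\<close>

instance chilbert_space \<subseteq> banach ..

section \<open>Orthonormal sequences\<close>

lemma cinner_add_right: "cinner x (y + z) = cinner x y + cinner (x::'a::chilbert_space) z"
  by (metis cinner_add_left cinner_commute complex_cnj_add)

lemma cinner_scaleC_right: "cinner x (c *\<^sub>C y) = cnj c * cinner (x::'a::chilbert_space) y"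
  by (metis cinner_commute cinner_scaleC_left complex_cnj_mult)

lemma cinner_zero_left [simp]: "cinner 0 (y::'a::chilbert_space) = 0"
  using cinner_add_left[of 0 0 y] by simp

lemma cinner_zero_right [simp]: "cinner (x::'a::chilbert_space) 0 = 0"
  using cinner_add_right[of x 0 0] by simp

text \<open>Conjugate symmetry makes the value real, and its real part is the real inner product,
  which induces the norm.\<close>

lemma cinner_self: "cinner x x = complex_of_real ((norm (x::'a::chilbert_space))\<^sup>2)"
proof -
  have "Im (cinner x x) = 0"
    using cinner_commute[of x x] by (metis complex_cnj_cancel_iff cnj.simps(2) neg_equal_zero)
  moreover have "Re (cinner x x) = (norm x)\<^sup>2"
    by (simp add: inner_eq_Re_cinner[symmetric] power2_norm_eq_inner)
  ultimately show ?thesis by (simp add: complex_eq_iff)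
qed

lemma cinner_self_eq_0 [simp]: "cinner x x = 0 \<longleftrightarrow> (x::'a::chilbert_space) = 0"
  by (simp add: cinner_self)

lemma cinner_sum_left: "cinner (sum f S) y = (\<Sum>i\<in>S. cinner (f i) (y::'a::chilbert_space))"
  by (induction S rule: infinite_finite_induct) (simp_all add: cinner_add_left)

text \<open>Conjugate-linearity in the second argument turns \<open>\<i>\<close> into
  \<open>-\<i>\<close>, which moves the imaginary part into the real part. Boundedness of
  \<open>cinner\<close> thereby reduces to that of \<open>inner\<close>.\<close>

lemma cinner_eq_Complex_inner:
  "cinner x y = Complex (inner x y) (inner x (\<i> *\<^sub>C (y::'a::chilbert_space)))"
  by (simp add: complex_eq_iff inner_eq_Re_cinner cinner_scaleC_right)

lemma bounded_linear_cinner_left: "bounded_linear (\<lambda>x. cinner x (y::'a::chilbert_space))"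
proof -
  have "bounded_linear (\<lambda>x. complex_of_real (inner x y) + \<i> * complex_of_real (inner x (\<i> *\<^sub>C y)))"
    by (intro bounded_linear_add bounded_linear_const_mult bounded_linear_of_real
        bounded_linear_compose[OF bounded_linear_of_real] bounded_linear_inner_left)
  then show ?thesis by (simp add: cinner_eq_Complex_inner Complex_eq)
qed

lemma norm_scaleC: "norm (c *\<^sub>C x) = cmod c * norm (x::'a::chilbert_space)"
proof (rule power2_eq_imp_eq)
  have "complex_of_real ((norm (c *\<^sub>C x))\<^sup>2) = complex_of_real ((cmod c * norm x)\<^sup>2)"
    unfolding cinner_self[symmetric] cinner_scaleC_left cinner_scaleC_right
    by (simp add: cinner_self power_mult_distrib)
      (metis complex_norm_square mult.commute of_real_power)
  then show "(norm (c *\<^sub>C x))\<^sup>2 = (cmod c * norm x)\<^sup>2" using of_real_eq_iff by blast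
qed auto

lemma bounded_linear_scaleC_right: "bounded_linear (\<lambda>x::'a::chilbert_space. c *\<^sub>C x)"
proof (rule bounded_linear_intro)
  show "c *\<^sub>C (r *\<^sub>R x) = r *\<^sub>R (c *\<^sub>C x)" for r and x :: 'a
    by (simp add: scaleR_scaleC scaleC_scaleC mult.commute)
  show "norm (c *\<^sub>C x) \<le> norm x * cmod c" for x :: 'a
    by (simp add: norm_scaleC mult.commute)
qed (rule scaleC_add_right)

text \<open>The vectors orthogonal to \<open>y\<close> form a closed complex subspace, so it
  suffices to test generators.\<close>

lemma cinner_closure_cspan_zero:
  fixes y :: "'a::chilbert_space"
  assumes "\<And>c. c \<in> C \<Longrightarrow> cinner c y = 0" and x: "x \<in> closure (cspan C)"
  shows "cinner x y = 0"
proof -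
  have "cspan C \<subseteq> {x. cinner x y = 0}"
    using assms(1) by (intro complex_vector.span_minimal)
      (auto simp: complex_vector.subspace_def cinner_add_left cinner_scaleC_left)
  moreover have "closed {x. cinner x y = 0}"
    by (intro closed_Collect_eq linear_continuous_on[OF bounded_linear_cinner_left] continuous_on_const)
  ultimately show ?thesis
    using x closure_minimal by blast
qed

text \<open>Subtracting from \<open>x\<close> its orthogonal projection \<open>y\<close> leaves a
  vector orthogonal to \<open>B\<close>, hence to the closed span of \<open>B\<close>, hence to
  itself. This will force a basis of an infinite-dimensional space to be infinite.\<close>

lemma cspan_finite_orthonormal:
  fixes B :: "'a::chilbert_space set"
  assumes "finite B" and B: "orthonormal_basis_of B UNIV"
  shows "cspan B = UNIV"
proof -
  have "x \<in> cspan B" for x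
  proof -
    define y where "y = (\<Sum>b\<in>B. cinner x b *\<^sub>C b)"
    have c: "cinner b b' = (if b = b' then 1 else 0)" if "b \<in> B" "b' \<in> B" for b b'
      using that B unfolding orthonormal_basis_of_def by blast
    have yb: "cinner y b = cinner x b" if b: "b \<in> B" for b
    proof -
      have "cinner y b = (\<Sum>b'\<in>B. cinner x b' * cinner b' b)"
        by (simp add: y_def cinner_sum_left cinner_scaleC_left)
      also have "\<dots> = (\<Sum>b'\<in>B. if b' = b then cinner x b else 0)"
        by (intro sum.cong) (auto simp: c b)
      finally show ?thesis using b \<open>finite B\<close> by simp
    qed
    have "cinner b (x - y) = 0" if "b \<in> B" for b
    proof -
      have "cinner (x - y) b = cinner x b - cinner y b"
        by (rule linear_diff[OF bounded_linear.linear[OF bounded_linear_cinner_left]])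
      then show ?thesis using yb[OF that] by (metis cinner_commute complex_cnj_zero diff_self)
    qed
    then have "cinner (x - y) (x - y) = 0"
      by (rule cinner_closure_cspan_zero[of B]) (use B in \<open>auto simp: orthonormal_basis_of_def\<close>)
    then have "x = y" by simp
    also have "y \<in> cspan B"
      unfolding y_def
      by (intro complex_vector.span_sum complex_vector.span_scale complex_vector.span_base)
    finally show ?thesis .
  qed
  then show ?thesis by blast
qed

text \<open>Distinct orthonormal vectors have squared distance 2. Points of a countable dense set
  chosen within 1/2 of each are therefore distinct: a shared point would put two of the vectors at
  distance less than 1.\<close>

lemma countable_orthonormal:
  fixes B :: "'a::chilbert_space set"
  assumes "separable_hilbert TYPE('a)"
    and B: "\<And>b c. b \<in> B \<Longrightarrow> c \<in> B \<Longrightarrow> cinner b c = (if b = c then 1 else 0)"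
  shows "countable B"
proof -
  obtain C :: "'a set" where C: "countable C" "closure C = UNIV"
    using assms(1) unfolding separable_hilbert_def separable_space_def by auto
  have "\<exists>c\<in>C. dist c b < 1/2" for b
    using C(2) closure_approachable[of b C] by (metis UNIV_I half_gt_zero_iff zero_less_one)
  then obtain h where h: "\<And>b. h b \<in> C" "\<And>b. dist (h b) b < 1/2" by metis
  have "inj_on h B"
  proof (rule inj_onI, rule ccontr)
    fix b c assume bc: "b \<in> B" "c \<in> B" "h b = h c" "b \<noteq> c"
    have "inner b b = 1" "inner c c = 1" "inner b c = 0" "inner c b = 0"
      using B bc by (simp_all add: inner_eq_Re_cinner)
    then have "(dist b c)\<^sup>2 = 2"
      by (simp add: dist_norm power2_norm_eq_inner inner_diff_left inner_diff_right)
    moreover have "dist b c < 1"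
      using h(2)[of b] h(2)[of c] bc(3) dist_triangle3[of b c "h b"] by simp
    ultimately show False
      using power_strict_mono[of "dist b c" 1 2] by simp
  qed
  moreover have "countable (h ` B)"
    using C(1) h(1) by (meson countable_subset image_subsetI)
  ultimately show ?thesis using countable_image_inj_on by blast
qed

section \<open>Fourier series along an orthonormal sequence\<close>

context
  fixes b :: "nat \<Rightarrow> 'a::chilbert_space"
  assumes orth: "\<And>m n. cinner (b m) (b n) = (if m = n then 1 else 0)"
begin

lemma norm_orthonormal_sum:
  assumes "finite F"
  shows "(norm (\<Sum>n\<in>F. c n *\<^sub>C b n))\<^sup>2 = (\<Sum>n\<in>F. (cmod (c n))\<^sup>2)"
proof -
  let ?y = "\<Sum>n\<in>F. c n *\<^sub>C b n"
  have y: "cinner (b m) ?y = cnj (c m)" if "m \<in> F" for m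
  proof -
    have "cinner ?y (b m) = (\<Sum>n\<in>F. if n = m then c m else 0)"
      unfolding cinner_sum_left by (intro sum.cong) (auto simp: cinner_scaleC_left orth)
    also have "\<dots> = c m" using that assms by simp
    finally show ?thesis by (subst cinner_commute) simp
  qed
  have "complex_of_real ((norm ?y)\<^sup>2) = (\<Sum>n\<in>F. c n * cinner (b n) ?y)"
    unfolding cinner_self[symmetric]
    by (subst cinner_sum_left) (simp add: cinner_scaleC_left)
  also have "\<dots> = (\<Sum>n\<in>F. complex_of_real ((cmod (c n))\<^sup>2))"
    by (intro sum.cong) (simp_all only: y complex_norm_square)
  finally show ?thesis by (metis of_real_eq_iff of_real_sum)
qed

text \<open>By Pythagoras (\<open>norm_orthonormal_sum\<close>), the squared norm of a block of the
  series is the same block of the convergent series of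
  \<open>(cmod (coord \<phi> k))\<^sup>2\<close>.\<close>

lemma summable_orthonormal: "summable (\<lambda>n. coord \<phi> n *\<^sub>C b n)"
  unfolding summable_Cauchy
proof (intro allI impI)
  fix e :: real assume e: "0 < e"
  obtain N where N: "\<forall>m\<ge>N. \<forall>n. norm (\<Sum>k=m..<n. (cmod (coord \<phi> k))\<^sup>2) < e\<^sup>2"
    using summable_coord[of \<phi>] e unfolding summable_Cauchy by (meson zero_less_power)
  have "norm (\<Sum>k=m..<n. coord \<phi> k *\<^sub>C b k) < e" if "m \<ge> N" for m n
  proof (rule power_less_imp_less_base)
    show "(norm (\<Sum>k=m..<n. coord \<phi> k *\<^sub>C b k))\<^sup>2 < e\<^sup>2"
      using N[rule_format, OF that, of n] by (simp add: norm_orthonormal_sum sum_nonneg)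
  qed (use e in simp)
  then show "\<exists>N. \<forall>m\<ge>N. \<forall>n. norm (\<Sum>k=m..<n. coord \<phi> k *\<^sub>C b k) < e" by blast
qed

text \<open>The synthesis map from sequences to vectors. Its inverse is the unitary sought; starting
  from this side leaves only surjectivity to be drawn from density of the span.\<close>

definition fourier_sum :: "ell2 \<Rightarrow> 'a" where
  "fourier_sum \<phi> = (\<Sum>n. coord \<phi> n *\<^sub>C b n)"

lemma cinner_fourier_sum: "cinner (fourier_sum \<phi>) x = (\<Sum>n. coord \<phi> n * cinner (b n) x)"
  unfolding fourier_sum_def
  by (simp add: bounded_linear.suminf[OF bounded_linear_cinner_left summable_orthonormal]
      cinner_scaleC_left)

lemma cinner_fourier_sum_basis: "cinner (fourier_sum \<phi>) (b n) = coord \<phi> n"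
proof -
  have "cinner (fourier_sum \<phi>) (b n) = (\<Sum>k. if k = n then coord \<phi> k else 0)"
    unfolding cinner_fourier_sum by (intro suminf_cong) (auto simp: orth)
  then show ?thesis using sums_single[of n "coord \<phi>"] by (metis sums_unique)
qed

lemma cinner_fourier_sum_fourier_sum: "cinner (fourier_sum \<phi>) (fourier_sum \<psi>) = cinner \<phi> \<psi>"
  unfolding cinner_fourier_sum cinner_ell2_def
  by (intro suminf_cong) (metis cinner_commute cinner_fourier_sum_basis)

lemma norm_fourier_sum: "norm (fourier_sum \<phi>) = norm \<phi>"
  unfolding norm_eq_sqrt_inner by (simp add: inner_eq_Re_cinner cinner_fourier_sum_fourier_sum)

lemma fourier_sum_add: "fourier_sum (\<phi> + \<psi>) = fourier_sum \<phi> + fourier_sum \<psi>"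
  unfolding fourier_sum_def suminf_add[OF summable_orthonormal summable_orthonormal]
  by (simp add: plus_ell2.rep_eq scaleC_add_left)

lemma fourier_sum_scaleC: "fourier_sum (c *\<^sub>C \<phi>) = c *\<^sub>C fourier_sum \<phi>"
  unfolding fourier_sum_def bounded_linear.suminf[OF bounded_linear_scaleC_right summable_orthonormal]
  by (simp add: scaleC_ell2.rep_eq scaleC_scaleC)

lemma bounded_linear_fourier_sum: "bounded_linear fourier_sum"
proof (rule bounded_linear_intro)
  show "norm (fourier_sum \<phi>) \<le> norm \<phi> * 1" for \<phi> by (simp add: norm_fourier_sum)
qed (simp_all add: fourier_sum_add fourier_sum_scaleC scaleR_scaleC)

lemma basis_in_range_fourier_sum: "b n \<in> range fourier_sum"
proof -
  define \<phi> where "\<phi> = Abs_ell2 (\<lambda>k. if k = n then 1 else 0)"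
  have "summable (\<lambda>k. (cmod (if k = n then 1 else 0))\<^sup>2)"
    by (rule summable_finite[of "{n}"]) auto
  then have "coord \<phi> = (\<lambda>k. if k = n then 1 else 0)"
    unfolding \<phi>_def by (intro Abs_ell2_inverse) simp
  then have "fourier_sum \<phi> = (\<Sum>k. if k = n then b k else 0)"
    unfolding fourier_sum_def by (intro suminf_cong) auto
  also have "\<dots> = b n" using sums_single[of n b] by (metis sums_unique)
  finally show ?thesis by (metis rangeI)
qed

text \<open>An isometric image of a complete space is complete, hence closed. The range is also a
  complex subspace containing every \<open>b n\<close>, so it contains the closed span of the
  sequence.\<close>

lemma surj_fourier_sum:
  assumes "closure (cspan (range b)) = UNIV"
  shows "surj fourier_sum"
proof -
  have "complete (range fourier_sum)"
    by (rule complete_isometric_image[where e = 1])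
      (auto simp: bounded_linear_fourier_sum norm_fourier_sum complete_UNIV)
  then have "closed (range fourier_sum)" by (rule complete_imp_closed)
  moreover have "cspan (range b) \<subseteq> range fourier_sum"
  proof (rule complex_vector.span_minimal)
    show "complex_vector.subspace (range fourier_sum)"
      unfolding complex_vector.subspace_def
      by (auto simp: fourier_sum_add[symmetric] fourier_sum_scaleC[symmetric]
          intro: range_eqI[of _ _ 0] simp: linear_0[OF bounded_linear.linear[OF bounded_linear_fourier_sum]])
  qed (use basis_in_range_fourier_sum in blast)
  ultimately show ?thesis using assms closure_minimal by blast
qed

text \<open>The analysis map, obtained as the inverse of \<open>fourier_sum\<close>, inherits
  linearity and isometry from it.\<close>

lemma fourier_unitary:
  assumes "closure (cspan (range b)) = UNIV"
  shows "\<exists>U. unitary_op U \<and> (\<forall>x n. coord (U x) n = cinner x (b n))"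
proof -
  have "inj fourier_sum"
    by (rule injI) (metis cinner_fourier_sum_basis coord_eqI)
  then have bij: "bij fourier_sum" using surj_fourier_sum[OF assms] by (simp add: bij_def)
  define U where "U = inv_into UNIV fourier_sum"
  have VU: "fourier_sum (U x) = x" and UV: "U (fourier_sum \<phi>) = \<phi>" for x \<phi>
    using bij by (simp_all add: U_def bij_is_surj surj_f_inv_f bij_is_inj)
  have add: "U (x + y) = U x + U y" for x y by (metis VU UV fourier_sum_add)
  have scale: "U (c *\<^sub>C x) = c *\<^sub>C U x" for c x by (metis VU UV fourier_sum_scaleC)
  have "bounded_linear U"
  proof (rule bounded_linear_intro)
    show "norm (U x) \<le> norm x * 1" for x using norm_fourier_sum[of "U x"] VU by simp
  qed (simp_all add: add scale scaleR_scaleC)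
  moreover have "bij U" unfolding U_def using bij by (rule bij_imp_bij_inv)
  moreover have "cinner (U x) (U y) = cinner x y" for x y
    by (metis VU cinner_fourier_sum_fourier_sum)
  moreover have "coord (U x) n = cinner x (b n)" for x n
    by (metis VU cinner_fourier_sum_basis)
  ultimately show ?thesis using scale unfolding unitary_op_def bounded_clinear_def by blast
qed

end

section \<open>Representations\<close>

context
  fixes A :: "'a cstar" and \<pi> :: "'a \<Rightarrow> 'h \<Rightarrow> 'h::chilbert_space"
  assumes alg: "cstar_algebra A" and rep: "representation A \<pi>"
begin

interpretation cstar_algebra A by (rule alg)

lemma rep_add: "a \<in> carrier A \<Longrightarrow> c \<in> carrier A \<Longrightarrow> \<pi> (a \<oplus>\<^bsub>A\<^esub> c) x = \<pi> a x + \<pi> c x"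
  and rep_mult: "a \<in> carrier A \<Longrightarrow> c \<in> carrier A \<Longrightarrow> \<pi> (a \<otimes>\<^bsub>A\<^esub> c) x = \<pi> a (\<pi> c x)"
  and rep_star: "a \<in> carrier A \<Longrightarrow> cinner (\<pi> a x) y = cinner x (\<pi> (star A a) y)"
  and rep_bounded_clinear: "a \<in> carrier A \<Longrightarrow> bounded_clinear (\<pi> a)"
  using rep unfolding representation_def by blast+

lemma rep_zero: "\<pi> \<zero>\<^bsub>A\<^esub> x = 0"
  using rep_add[of "\<zero>\<^bsub>A\<^esub>" "\<zero>\<^bsub>A\<^esub>" x] by simp

lemma rep_minus:
  assumes "a \<in> carrier A" "c \<in> carrier A"
  shows "\<pi> (a \<ominus>\<^bsub>A\<^esub> c) x = \<pi> a x - \<pi> c x"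
proof -
  have "\<pi> c x + \<pi> (\<ominus>\<^bsub>A\<^esub> c) x = 0"
    using rep_add[of c "\<ominus>\<^bsub>A\<^esub> c" x] assms rep_zero by (simp add: r_neg)
  then have "\<pi> (\<ominus>\<^bsub>A\<^esub> c) x = - \<pi> c x"
    by (simp add: add_eq_0_iff)
  then show ?thesis using assms by (simp add: minus_eq rep_add)
qed

lemma rep_image_zero: "a \<in> carrier A \<Longrightarrow> \<pi> a 0 = 0"
  using rep_bounded_clinear[of a] unfolding bounded_clinear_def
  by (intro linear_0) (auto intro: bounded_linear.linear)

lemma rep_finsum:
  assumes "finite F" "\<And>i. i \<in> F \<Longrightarrow> a i \<in> carrier A"
  shows "\<pi> (\<Oplus>\<^bsub>A\<^esub>i\<in>F. a i) x = (\<Sum>i\<in>F. \<pi> (a i) x)"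
  using assms
proof (induction F)
  case (insert i F)
  then show ?case
    by (subst finsum_insert) (auto simp: rep_add Pi_def intro!: finsum_closed)
qed (simp add: rep_zero)

text \<open>The squared norm of \<open>\<pi> (star A a) x\<close> is the inner product of
  \<open>x\<close> with \<open>\<pi> (a \<otimes> star A a) x\<close>. It serves to show that the
  adjoint of \<open>s e\<close> kills the basis vectors outside its range projection.\<close>

lemma rep_star_mult_eq_0:
  assumes a: "a \<in> carrier A" and "\<pi> (a \<otimes>\<^bsub>A\<^esub> star A a) x = 0"
  shows "\<pi> (star A a) x = 0"
proof -
  have "cinner (\<pi> (star A a) x) (\<pi> (star A a) x) = cinner x (\<pi> (a \<otimes>\<^bsub>A\<^esub> star A a) x)"
    using a by (simp add: rep_star star_closed star_star rep_mult)
  then show ?thesis using assms(2) by simp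
qed

text \<open>A vector of \<open>C\<close> lies in the range of the idempotent \<open>\<pi> q\<close>
  and is fixed. Any other basis vector \<open>b\<close> is orthogonal to \<open>C\<close>, hence to
  that range, and the squared norm of \<open>\<pi> q b\<close> is the inner product of
  \<open>\<pi> q b\<close> with \<open>b\<close>, which is 0.\<close>

lemma rep_projection_basis:
  assumes q: "is_projection A q"
    and B: "\<And>b c. b \<in> B \<Longrightarrow> c \<in> B \<Longrightarrow> cinner b c = (if b = c then 1 else 0)"
    and C: "C \<subseteq> B" "orthonormal_basis_of C (range (\<pi> q))" and b: "b \<in> B"
  shows "\<pi> q b = (if b \<in> C then b else 0)"
proof -
  have q': "q \<in> carrier A" "star A q = q" "q \<otimes>\<^bsub>A\<^esub> q = q" using q by (auto simp: is_projection_def)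
  have idem: "\<pi> q (\<pi> q x) = \<pi> q x" for x using rep_mult[of q q x] q' by simp
  have cl: "closure (cspan C) = range (\<pi> q)" using C(2) by (simp add: orthonormal_basis_of_def)
  show ?thesis
  proof (cases "b \<in> C")
    case True
    then have "b \<in> range (\<pi> q)"
      using cl closure_subset complex_vector.span_base[of b C] by blast
    then show ?thesis using True idem by auto
  next
    case False
    have "cinner (\<pi> q b) b = 0"
    proof (rule cinner_closure_cspan_zero)
      show "\<pi> q b \<in> closure (cspan C)" using cl by simp
      show "cinner c b = 0" if "c \<in> C" for c using that B[of c b] C(1) b False by auto
    qed
    moreover have "cinner (\<pi> q b) (\<pi> q b) = cinner (\<pi> q b) b"
      using rep_star[of q "\<pi> q b" b] q' idem by simp
    ultimately show ?thesis using False by simp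
  qed
qed

text \<open>The inverse of \<open>U\<close> is its adjoint (\<open>adj\<close>), so conjugation
  respects the star; products are respected because the inner \<open>U\<close> and its inverse
  cancel.\<close>

lemma representation_conjugate:
  fixes U :: "'h \<Rightarrow> 'k::chilbert_space"
  assumes U: "unitary_op U"
  shows "representation A (\<lambda>a y. U (\<pi> a (inv_into UNIV U y)))"
    and "unitarily_equivalent A \<pi> (\<lambda>a y. U (\<pi> a (inv_into UNIV U y)))"
proof -
  have bl: "bounded_linear U" and bij: "bij U" and sc: "\<And>c x. U (c *\<^sub>C x) = c *\<^sub>C U x"
    and ci: "\<And>x y. cinner (U x) (U y) = cinner x y"
    using U by (auto simp: unitary_op_def bounded_clinear_def)
  have UV: "U (inv_into UNIV U y) = y" and VU: "inv_into UNIV U (U x) = x" for x y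
    using bij by (simp_all add: bij_is_surj surj_f_inv_f bij_is_inj)
  have U_add: "U (x + y) = U x + U y" for x y
    using bounded_linear.linear[OF bl] by (rule linear_add)
  have add: "inv_into UNIV U (x + y) = inv_into UNIV U x + inv_into UNIV U y" for x y
    by (metis UV VU U_add)
  have scale: "inv_into UNIV U (c *\<^sub>C x) = c *\<^sub>C inv_into UNIV U x" for c x by (metis UV VU sc)
  have nU: "norm (U x) = norm x" for x
    unfolding norm_eq_sqrt_inner by (simp add: inner_eq_Re_cinner ci)
  have blV: "bounded_linear (inv_into UNIV U)"
  proof (rule bounded_linear_intro)
    show "norm (inv_into UNIV U x) \<le> norm x * 1" for x using nU[of "inv_into UNIV U x"] UV by simp
  qed (simp_all add: add scale scaleR_scaleC)
  have adj: "cinner (U x) y = cinner x (inv_into UNIV U y)" "cinner y (U x) = cinner (inv_into UNIV U y) x" for x y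
    by (metis UV ci)+
  have "bounded_clinear (\<lambda>y. U (\<pi> a (inv_into UNIV U y)))" if "a \<in> carrier A" for a
  proof -
    have "bounded_linear (\<pi> a)" and "\<And>c x. \<pi> a (c *\<^sub>C x) = c *\<^sub>C \<pi> a x"
      using rep_bounded_clinear[OF that] by (auto simp: bounded_clinear_def)
    then show ?thesis
      using bounded_linear_compose[OF bl bounded_linear_compose[OF _ blV]]
      by (simp add: bounded_clinear_def scale sc)
  qed
  then show "representation A (\<lambda>a y. U (\<pi> a (inv_into UNIV U y)))"
    using rep unfolding representation_def by (simp add: U_add sc VU adj)
  show "unitarily_equivalent A \<pi> (\<lambda>a y. U (\<pi> a (inv_into UNIV U y)))"
    unfolding unitarily_equivalent_def using U VU by auto
qed

end

section \<open>The branching system of an enumerated permutative basis\<close>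

text \<open>Bijections preserve cardinality. Absolute continuity in the branching system then
  becomes a comparison of a measure with itself.\<close>

lemma distr_restrict_count_space_bij:
  assumes "bij_betw f D R"
  shows "distr (restrict_space (count_space UNIV) D) (restrict_space (count_space UNIV) R) f
    = restrict_space (count_space UNIV) R"
  using distr_bij_count_space[OF assms] by (simp add: restrict_count_space)

text \<open>The pushforward is the counting measure on \<open>R e\<close>, so the constant 1 is a
  density. Densities agree almost everywhere, which for counting measure means at every
  point.\<close>

lemma branching_RN_deriv_count_space:
  fixes f :: "'e \<Rightarrow> nat \<Rightarrow> nat"
  assumes "bij_betw (f e) (D (rng G e)) (R e)" and "n \<in> R e"
  shows "branching_RN_deriv G (count_space UNIV) R D f e n = 1"
proof -
  let ?M = "count_space (R e)"
  interpret sigma_finite_measure ?M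
    by (rule sigma_finite_measure_count_space_countable) simp
  have "AE x in ?M. 1 = RN_deriv ?M ?M x"
    by (rule RN_deriv_unique) (simp_all add: density_1)
  then have "RN_deriv ?M ?M n = 1" using assms(2) by (simp add: AE_count_space)
  then show ?thesis
    unfolding branching_RN_deriv_def Let_def distr_restrict_count_space_bij[where R = "R e", OF assms(1)]
    by (simp add: restrict_count_space)
qed

theorem theorem6p4:
  fixes G :: "('v, 'e) ultragraph_data"
    and A :: "'a cstar" and s :: "'e \<Rightarrow> 'a" and p :: "'v set \<Rightarrow> 'a"
    and \<pi> :: "'a \<Rightarrow> 'h \<Rightarrow> 'h::chilbert_space" and B :: "'h set"
  assumes "ultragraph G"
    and "universal_cstar_algebra G A s p"
    and "separable_hilbert TYPE('h)" and "infinite_dimensional TYPE('h)"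
    and "permutative G A s p \<pi>"
    and "permutative_basis G A s p \<pi> B"
  shows "\<exists>(R :: 'e \<Rightarrow> nat set) D f g (\<rho> :: 'a \<Rightarrow> ell2 \<Rightarrow> ell2).
    branching_system G (count_space UNIV) R D f g \<and>
    induced_representation G A s p R D f g \<rho> \<and>
    unitarily_equivalent A \<pi> \<rho>"
proof -
  have alg: "cstar_algebra A" and fam: "ultragraph_family G A s p"
    using assms(2) by (auto simp: universal_cstar_algebra_def)
  have rep: "representation A \<pi>" using assms(5) by (simp add: permutative_def)
  interpret cstar_algebra A by (rule alg)
  note r_mult = rep_mult[OF alg rep] and r_star = rep_star[OF alg rep]

  \<comment> \<open>Relations among the generators in the algebra\<close>
  have src: "src G e \<in> verts G" if "e \<in> edges G" for e
    using assms(1) that by (simp add: ultragraph_def)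
  have s_iso: "is_partial_isometry A (s e)" if "e \<in> edges G" for e
    using fam that by (simp add: ultragraph_family_def)
  then have s_carrier: "s e \<in> carrier A" if "e \<in> edges G" for e
    using that by (simp add: is_partial_isometry_def)
  have orth: "(s e \<otimes>\<^bsub>A\<^esub> star A (s e)) \<otimes>\<^bsub>A\<^esub> (s e' \<otimes>\<^bsub>A\<^esub> star A (s e')) = \<zero>\<^bsub>A\<^esub>"
    if "e \<in> edges G" "e' \<in> edges G" "e \<noteq> e'" for e e'
    using fam that unfolding ultragraph_family_def by blast
  have p_proj: "is_projection A (p X)" if "X \<in> gen_verts G" for X
    using fam that by (simp add: ultragraph_family_def)
  then have p_carrier: "p X \<in> carrier A" if "X \<in> gen_verts G" for X
    using that by (simp add: is_projection_def)
  have p_empty: "p {} = \<zero>\<^bsub>A\<^esub>" using fam by (simp add: ultragraph_family_def)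
  have p_inter: "p X \<otimes>\<^bsub>A\<^esub> p Y = p (X \<inter> Y)"
    and p_union: "p (X \<union> Y) = p X \<oplus>\<^bsub>A\<^esub> p Y \<ominus>\<^bsub>A\<^esub> p (X \<inter> Y)"
    if "X \<in> gen_verts G" "Y \<in> gen_verts G" for X Y
    using fam that unfolding ultragraph_family_def by blast+
  have p_range: "star A (s e) \<otimes>\<^bsub>A\<^esub> s e = p (rng G e)" if "e \<in> edges G" for e
    using fam that by (simp add: ultragraph_family_def)
  have p_sum: "p {v} = (\<Oplus>\<^bsub>A\<^esub>e\<in>out_edges G v. s e \<otimes>\<^bsub>A\<^esub> star A (s e))"
    if "v \<in> verts G" "out_edges G v \<noteq> {}" "finite (out_edges G v)" for v
    using fam that by (simp add: ultragraph_family_def)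

  \<comment> \<open>The range projection of \<open>s e\<close>; its idempotence is the partial
    isometry identity multiplied on the right by \<open>star A (s e)\<close>.\<close>
  define q where "q e = s e \<otimes>\<^bsub>A\<^esub> star A (s e)" for e
  have q_proj: "is_projection A (q e)" if "e \<in> edges G" for e
  proof -
    have c: "s e \<in> carrier A" "star A (s e) \<in> carrier A" using s_carrier that star_closed by auto
    have "s e \<otimes>\<^bsub>A\<^esub> star A (s e) \<otimes>\<^bsub>A\<^esub> s e = s e" using s_iso[OF that] by (simp add: is_partial_isometry_def)
    then have "q e \<otimes>\<^bsub>A\<^esub> q e = q e"
      unfolding q_def using c by (simp add: m_assoc[symmetric] m_closed)
    then show ?thesis using c by (simp add: is_projection_def q_def m_closed star_mult star_star)
  qed
  then have q_carrier: "q e \<in> carrier A" if "e \<in> edges G" for e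
    using that by (simp add: is_projection_def)

  have Bbasis: "orthonormal_basis_of B UNIV"
    using assms(6) by (simp add: permutative_basis_def)
  then have Borth: "cinner b c = (if b = c then 1 else 0)" if "b \<in> B" "c \<in> B" for b c
    using that unfolding orthonormal_basis_of_def by blast
  obtain BV BE where
    BV_v: "\<forall>v\<in>verts G. orthonormal_basis_of (BV {v}) (range (\<pi> (p {v})))" and
    BV_r: "\<forall>e\<in>edges G. orthonormal_basis_of (BV (rng G e)) (range (\<pi> (p (rng G e))))" and
    BE: "\<forall>e\<in>edges G. orthonormal_basis_of (BE e) (range (\<pi> (q e)))" and
    BV_r_sub: "\<forall>e\<in>edges G. BV (rng G e) \<subseteq> B" and
    BV_v_sub: "\<forall>v\<in>verts G. BV {v} \<subseteq> B" and
    BE_sub: "\<forall>v\<in>verts G. (\<Union>e\<in>out_edges G v. BE e) \<subseteq> BV {v}" and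
    image: "\<forall>e\<in>edges G. \<pi> (s e) ` BV (rng G e) = BE e"
    using assms(6) unfolding permutative_basis_def q_def[symmetric]
    by (elim conjE exE) (rule that; assumption)
  note BV_v = bspec[OF BV_v] and BV_r = bspec[OF BV_r] and BE = bspec[OF BE]
    and BV_r_sub = bspec[OF BV_r_sub] and BV_v_sub = bspec[OF BV_v_sub]
    and BE_sub = bspec[OF BE_sub] and image = bspec[OF image]
  have BE_src: "BE e \<subseteq> BV {src G e}" if "e \<in> edges G" for e
    using BE_sub[OF src[OF that]] that by (auto simp: out_edges_def)
  then have BE_B: "BE e \<subseteq> B" if "e \<in> edges G" for e
    using BV_v_sub[OF src[OF that]] that by blast

  \<comment> \<open>Separability bounds the basis above and infinite dimension below, so all of
    \<open>nat\<close> indexes it without repetition.\<close>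
  have "countable B" using countable_orthonormal[OF assms(3) Borth] .
  moreover have "infinite B"
    using cspan_finite_orthonormal[OF _ Bbasis] assms(4) unfolding infinite_dimensional_def by blast
  ultimately obtain b :: "nat \<Rightarrow> 'h" where "bij_betw b UNIV B"
    by (meson bij_betw_from_nat_into)
  then have inj: "inj b" and rangeb: "range b = B" by (auto simp: bij_betw_def)
  have bB: "b n \<in> B" for n using rangeb by auto
  have b_inv: "b (inv_into UNIV b x) = x" if "x \<in> B" for x using that rangeb by (simp add: f_inv_into_f)
  have b_orth: "cinner (b m) (b n) = (if m = n then 1 else 0)" for m n
    using Borth[OF bB bB] inj by (simp add: inj_eq)
  have b0: "b n \<noteq> 0" for n using b_orth[of n n] by force

  \<comment> \<open>Diagonal action of the projections on the enumerated basis\<close>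
  have pv: "\<pi> (p {v}) (b n) = (if b n \<in> BV {v} then b n else 0)" if "v \<in> verts G" for v n
    using rep_projection_basis[OF alg rep p_proj Borth BV_v_sub BV_v bB] that
    by (simp add: gen_verts.singleton)
  have pr: "\<pi> (p (rng G e)) (b n) = (if b n \<in> BV (rng G e) then b n else 0)" if "e \<in> edges G" for e n
    using rep_projection_basis[OF alg rep p_proj Borth BV_r_sub BV_r bB] that
    by (simp add: gen_verts.range)
  have qb: "\<pi> (q e) (b n) = (if b n \<in> BE e then b n else 0)" if "e \<in> edges G" for e n
    using rep_projection_basis[OF alg rep q_proj Borth BE_B BE bB] that by simp

  have p_inter_b: "\<pi> (p (X \<inter> Y)) x = \<pi> (p X) (\<pi> (p Y) x)"
    and p_union_b: "\<pi> (p (X \<union> Y)) x = \<pi> (p X) x + \<pi> (p Y) x - \<pi> (p X) (\<pi> (p Y) x)"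
    if "X \<in> gen_verts G" "Y \<in> gen_verts G" for X Y x
  proof -
    show 1: "\<pi> (p (X \<inter> Y)) x = \<pi> (p X) (\<pi> (p Y) x)"
      using p_inter[OF that] p_carrier that r_mult by metis
    show "\<pi> (p (X \<union> Y)) x = \<pi> (p X) x + \<pi> (p Y) x - \<pi> (p X) (\<pi> (p Y) x)"
      unfolding p_union[OF that] 1[symmetric] using that
      by (simp add: rep_minus[OF alg rep] rep_add[OF alg rep] p_carrier gen_verts.inter)
  qed
  \<comment> \<open>Bases inside \<open>B\<close> are given only for vertices and edge ranges. For
    other sets of \<open>gen_verts G\<close> the dichotomy spreads by induction, since eigenvalues 0
    and 1 are preserved by \<open>p_inter_b\<close> and \<open>p_union_b\<close>.\<close>
  have diag: "\<pi> (p X) (b n) = b n \<or> \<pi> (p X) (b n) = 0" if "X \<in> gen_verts G" for X n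
    using that
  proof (induction X)
    case empty
    then show ?case by (simp add: p_empty rep_zero[OF alg rep])
  next
    case (union X Y)
    then show ?case using p_union_b[of X Y "b n"] rep_image_zero[OF alg rep p_carrier] by auto
  next
    case (inter X Y)
    then show ?case using p_inter_b[of X Y "b n"] rep_image_zero[OF alg rep p_carrier] by auto
  qed (auto simp: pv pr)

  \<comment> \<open>Fixed vectors of the projection define \<open>D\<close> uniformly for all sets;
    \<open>Dv\<close> and \<open>Dr\<close> recover membership in the given bases for vertices and
    edge ranges.\<close>
  define D where "D X = {n. \<pi> (p X) (b n) = b n}" for X
  define R where "R e = {n. b n \<in> BE e}" for e
  \<comment> \<open>The action of \<open>s e\<close> and its adjoint on basis vectors, read on
    indices. Where the image vector is not in \<open>B\<close>, \<open>inv_into\<close> returns an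
    unspecified index, so facts about \<open>f\<close> and \<open>g\<close> are confined to
    \<open>D (rng G e)\<close> and \<open>R e\<close>.\<close>
  define f where "f e n = inv_into UNIV b (\<pi> (s e) (b n))" for e n
  define g where "g e n = inv_into UNIV b (\<pi> (star A (s e)) (b n))" for e n

  have pD: "\<pi> (p X) (b n) = (if n \<in> D X then b n else 0)" if "X \<in> gen_verts G" for X n
    using diag[OF that] by (auto simp: D_def)
  have Dv: "D {v} = {n. b n \<in> BV {v}}" if "v \<in> verts G" for v
    using pv[OF that] b0 by (auto simp: D_def)
  have Dr: "D (rng G e) = {n. b n \<in> BV (rng G e)}" if "e \<in> edges G" for e
    using pr[OF that] b0 by (auto simp: D_def)
  have D_inter: "D X \<inter> D Y = D (X \<inter> Y)" and D_union: "D X \<union> D Y = D (X \<union> Y)"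
    if "X \<in> gen_verts G" "Y \<in> gen_verts G" for X Y
  proof -
    show "D X \<inter> D Y = D (X \<inter> Y)"
      unfolding D_def[of "X \<inter> Y"]
      using that b0 rep_image_zero[OF alg rep p_carrier] by (auto simp: p_inter_b pD split: if_splits)
    show "D X \<union> D Y = D (X \<union> Y)"
      unfolding D_def[of "X \<union> Y"]
      using that b0 rep_image_zero[OF alg rep p_carrier] by (auto simp: p_union_b pD split: if_splits)
  qed
  have R_disj: "R e \<inter> R e' = {}" if e: "e \<in> edges G" "e' \<in> edges G" "e \<noteq> e'" for e e'
  proof -
    have False if "n \<in> R e" "n \<in> R e'" for n
    proof -
      \<comment> \<open>A common index would be fixed by both range projections, whose product is
        zero.\<close>
      have "b n = \<pi> (q e) (\<pi> (q e') (b n))" using that e by (simp add: qb R_def)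
      also have "\<dots> = \<pi> (q e \<otimes>\<^bsub>A\<^esub> q e') (b n)" using e by (simp add: r_mult q_carrier)
      also have "\<dots> = 0" using orth[OF e] by (simp add: q_def rep_zero[OF alg rep])
      finally show False using b0 by simp
    qed
    then show ?thesis by blast
  qed
  have D_sum: "D {v} = (\<Union>e\<in>out_edges G v. R e)"
    if v: "v \<in> verts G" "out_edges G v \<noteq> {}" "finite (out_edges G v)" for v
  proof
    show "(\<Union>e\<in>out_edges G v. R e) \<subseteq> D {v}"
      using BE_sub[OF v(1)] by (auto simp: Dv[OF v(1)] R_def)
    show "D {v} \<subseteq> (\<Union>e\<in>out_edges G v. R e)"
    proof (rule subsetI, rule ccontr)
      fix n assume n: "n \<in> D {v}" "n \<notin> (\<Union>e\<in>out_edges G v. R e)"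
      \<comment> \<open>The Cuntz-Krieger relation at \<open>v\<close>: every summand kills
        \<open>b n\<close>, whereas \<open>p {v}\<close> fixes this nonzero vector.\<close>
      have "p {v} = (\<Oplus>\<^bsub>A\<^esub>e\<in>out_edges G v. q e)" using p_sum[OF v] by (simp add: q_def)
      then have "\<pi> (p {v}) (b n) = (\<Sum>e\<in>out_edges G v. \<pi> (q e) (b n))"
        using rep_finsum[OF alg rep v(3), of q] q_carrier by (simp add: out_edges_def)
      also have "\<dots> = 0"
        using n(2) by (intro sum.neutral) (auto simp: qb out_edges_def R_def)
      finally show False using n(1) b0 by (auto simp: D_def)
    qed
  qed

  \<comment> \<open>The mutually inverse maps between the index sets\<close>
  have bf: "b (f e n) = \<pi> (s e) (b n)" and fR: "f e n \<in> R e"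
    if "e \<in> edges G" "n \<in> D (rng G e)" for e n
  proof -
    have "\<pi> (s e) (b n) \<in> BE e" using image that Dr by blast
    then show "b (f e n) = \<pi> (s e) (b n)" using BE_B that b_inv unfolding f_def by blast
    then show "f e n \<in> R e" using \<open>\<pi> (s e) (b n) \<in> BE e\<close> by (simp add: R_def)
  qed
  have s_star_s: "\<pi> (star A (s e)) (\<pi> (s e) x) = \<pi> (p (rng G e)) x" if "e \<in> edges G" for e x
    using r_mult[of "star A (s e)" "s e" x] s_carrier[OF that] star_closed p_range[OF that] by simp
  have gf: "g e (f e n) = n" if "e \<in> edges G" "n \<in> D (rng G e)" for e n
    unfolding g_def bf[OF that] s_star_s[OF that(1)] using that inj by (simp add: D_def inv_f_f)
  have bg: "b (g e n) = \<pi> (star A (s e)) (b n)" and gD: "g e n \<in> D (rng G e)" and fg: "f e (g e n) = n"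
    if e: "e \<in> edges G" and n: "n \<in> R e" for e n
  proof -
    \<comment> \<open>Since \<open>\<pi> (s e)\<close> carries the basis of its domain onto
      \<open>BE e\<close>, the vector \<open>b n\<close> has a basis vector as preimage; the index
      \<open>m\<close> of that preimage turns out to be \<open>g e n\<close>.\<close>
    have "b n \<in> \<pi> (s e) ` BV (rng G e)" using n image[OF e] by (simp add: R_def)
    then obtain x where x: "b n = \<pi> (s e) x" "x \<in> BV (rng G e)" by (rule imageE)
    then have "x \<in> B" using BV_r_sub[OF e] by auto
    then obtain m where m: "x = b m" using rangeb by auto
    then have mD: "m \<in> D (rng G e)" using x(2) Dr[OF e] by simp
    have "f e m = n" unfolding f_def m[symmetric] x(1)[symmetric] using inj by (rule inv_f_f)
    then have gm: "g e n = m" using gf[OF e mD] by simp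
    show "g e n \<in> D (rng G e)" "f e (g e n) = n" using gm mD \<open>f e m = n\<close> by simp_all
    show "b (g e n) = \<pi> (star A (s e)) (b n)"
      unfolding gm x(1) s_star_s[OF e] using mD m by (simp add: D_def)
  qed
  have f_bij: "bij_betw (f e) (D (rng G e)) (R e)" and g_bij: "bij_betw (g e) (R e) (D (rng G e))"
    if "e \<in> edges G" for e
    using that by (auto intro: bij_betw_byWitness[where f' = "g e"]
        bij_betw_byWitness[where f' = "f e"] simp: gf fg fR gD)
  have s_star_zero: "\<pi> (star A (s e)) (b n) = 0" if "e \<in> edges G" "n \<notin> R e" for e n
    using that qb[of e n] s_carrier by (intro rep_star_mult_eq_0[OF alg rep]) (auto simp: R_def q_def)

  \<comment> \<open>Verification of the branching system axioms\<close>
  have bs: "branching_system G (count_space UNIV) R D f g"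
    unfolding branching_system_def Let_def
  proof (intro conjI ballI impI)
    show "sigma_finite_measure (count_space (UNIV :: nat set))"
      by (rule sigma_finite_measure_count_space_countable) simp
    show "D {} = {}" using b0 by (auto simp: D_def p_empty rep_zero[OF alg rep])
    show "AE n in count_space UNIV. n \<in> R e \<longrightarrow> n \<in> D {src G e}" if "e \<in> edges G" for e
      using BE_src[OF that] src[OF that] by (auto simp: AE_count_space Dv R_def)
  next
    fix e assume e: "e \<in> edges G"
    show "f e \<in> measurable (restrict_space (count_space UNIV) (D (rng G e))) (restrict_space (count_space UNIV) (R e))"
      "g e \<in> measurable (restrict_space (count_space UNIV) (R e)) (restrict_space (count_space UNIV) (D (rng G e)))"
      using fR[OF e] gD[OF e] by (auto simp: restrict_count_space)
    show "absolutely_continuous (restrict_space (count_space UNIV) (D (rng G e)))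
        (distr (restrict_space (count_space UNIV) (R e)) (restrict_space (count_space UNIV) (D (rng G e))) (g e))"
      unfolding distr_restrict_count_space_bij[OF g_bij[OF e]] by (simp add: absolutely_continuous_def)
    show "absolutely_continuous (restrict_space (count_space UNIV) (R e))
        (distr (restrict_space (count_space UNIV) (D (rng G e))) (restrict_space (count_space UNIV) (R e)) (f e))"
      unfolding distr_restrict_count_space_bij[OF f_bij[OF e]] by (simp add: absolutely_continuous_def)
  qed (use R_disj D_inter D_union D_sum fg gf in
      \<open>auto simp: AE_count_space restrict_count_space simp flip: D_inter D_union\<close>)

  \<comment> \<open>Transport to sequences and the induced formulas\<close>
  have "closure (cspan (range b)) = UNIV"
    using Bbasis by (simp add: rangeb orthonormal_basis_of_def)
  then obtain U where U: "unitary_op U" and Uc: "\<And>x n. coord (U x) n = cinner x (b n)"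
    using fourier_unitary[of b, OF b_orth] by blast
  define \<rho> where "\<rho> = (\<lambda>a y. U (\<pi> a (inv_into UNIV U y)))"
  have coord_inv: "cinner (inv_into UNIV U \<phi>) (b n) = coord \<phi> n" for \<phi> n
    using U Uc[of "inv_into UNIV U \<phi>" n] by (simp add: unitary_op_def bij_is_surj surj_f_inv_f)
  have "coord (\<rho> (s e) \<phi>) n =
        (if n \<in> R e
         then complex_of_real (sqrt (branching_RN_deriv G (count_space UNIV) R D f e n)) * coord \<phi> (g e n)
         else 0)" if e: "e \<in> edges G" for e \<phi> n
  proof -
    \<comment> \<open>Coordinates are inner products with \<open>b n\<close>, so \<open>s e\<close>
      moves across as its adjoint. That sends \<open>b n\<close> to \<open>b (g e n)\<close> on
      \<open>R e\<close> and to 0 elsewhere, matching the induced formula with derivative 1.\<close>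
    have "coord (\<rho> (s e) \<phi>) n = cinner (inv_into UNIV U \<phi>) (\<pi> (star A (s e)) (b n))"
      by (simp add: \<rho>_def Uc r_star s_carrier[OF e])
    then show ?thesis
      using e by (simp add: s_star_zero bg[symmetric] coord_inv branching_RN_deriv_count_space f_bij)
  qed
  moreover have "coord (\<rho> (p X) \<phi>) n = indicator (D X) n * coord \<phi> n" if "X \<in> gen_verts G" for X \<phi> n
  proof -
    have "coord (\<rho> (p X) \<phi>) n = cinner (inv_into UNIV U \<phi>) (\<pi> (p X) (b n))"
      using p_proj[OF that] by (simp add: \<rho>_def Uc r_star is_projection_def)
    then show ?thesis by (simp add: pD that coord_inv)
  qed
  ultimately have "induced_representation G A s p R D f g \<rho>"
    using bs representation_conjugate(1)[OF alg rep U]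
    unfolding induced_representation_def \<rho>_def[symmetric] by blast
  then show ?thesis
    using bs representation_conjugate(2)[OF alg rep U] unfolding \<rho>_def[symmetric] by blast
qed

end
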